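(* Let $M$ be a loopless matroid of positive rank $r$. Then, for every integer $0\leq j<r$, $$\left.\frac{\partial^j}{\partial s^j}Z^{\mathrm{top}}_M(s)\right|_{s=0}=\left.\frac{\partial^j}{\partial s^j}Z^{\mathrm{top}}_{\mathrm{tr}(M)}(s)\right|_{s=0},$$ where $\mathrm{tr}(M)$ denotes the truncation of $M$.
   Context: For a loopless matroid $M$ on a finite ground set $E$, $\mathcal{L}(M)$ is its lattice of flats (with bottom $\varnothing$ and top $E$), $\mu_{F,G}$ is the Möbius function of $\mathcal{L}(M)$, and for a flat $F$, $M|_F$ and $M/F$ denote restriction to and contraction by $F$ (both are loopless). The characteristic polynomial is $\chi_M(x)=\sum_{F\in\mathcal{L}(M)}\mu_{\varnothing,F}\,x^{\mathrm{rk}(M)-\mathrm{rk}_M(F)}$, and for $\mathrm{rk}(M)>0$ the reduced characteristic polynomial is $\overline{\chi}_M(x)=\chi_M(x)/(x-1)$. The topological zeta function $Z^{\mathrm{top}}_M(s)\in\mathbb{Q}(s)$ is defined for all loopless matroids recursively as follows. If $\mathrm{rk}(M)=0$, then $Z^{\mathrm{top}}_M(s)=1$. If $\mathrm{rk}(M)=r>0$ and $|E|=n$, then $$Z^{\mathrm{top}}_M(s)=\frac{1}{ns+r}\sum_{F\in\mathcal{L}(M),\ F\neq E}Z^{\mathrm{top}}_{M|_F}(s)\,\overline{\chi}_{M/F}(1).$$ This rational function has no pole at $s=0$. The truncation $\mathrm{tr}(M)$ of a matroid $M$ of rank $r\geq 1$ is the matroid of rank $r-1$ on the same ground set whose independent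 sets are the independent sets of $M$ of cardinality at most $r-1$. It is loopless if $M$ is loopless and $r\geq 2$; when $r=1$, $\mathrm{tr}(M)$ has rank $0$ and one sets $Z^{\mathrm{top}}_{\mathrm{tr}(M)}(s)=1$. *)

theory Defs
  imports "HOL-Computational_Algebra.Computational_Algebra" "HOL-Computational_Algebra.Field_as_Ring"
begin

section \<open>Matroids\<close>

datatype 'a indep_system = Indep_System (ground: "'a set") (indep: "'a set \<Rightarrow> bool")

definition matroid :: "'a indep_system \<Rightarrow> bool" where
  "matroid M \<longleftrightarrow>
     finite (ground M) \<and>
     (\<forall>I. indep M I \<longrightarrow> I \<subseteq> ground M) \<and>
     indep M {} \<and>
     (\<forall>I J. indep M I \<longrightarrow> J \<subseteq> I \<longrightarrow> indep M J) \<and>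
     (\<forall>I J. indep M I \<longrightarrow> indep M J \<longrightarrow> card I < card J \<longrightarrow>
        (\<exists>x\<in>J - I. indep M (insert x I)))"

definition loopless :: "'a indep_system \<Rightarrow> bool" where
  "loopless M \<longleftrightarrow> (\<forall>x\<in>ground M. indep M {x})"

definition rank_of :: "'a indep_system \<Rightarrow> 'a set \<Rightarrow> nat" where
  "rank_of M A = Max {card I | I. I \<subseteq> A \<and> indep M I}"

definition rk :: "'a indep_system \<Rightarrow> nat" where
  "rk M = rank_of M (ground M)"

definition flats :: "'a indep_system \<Rightarrow> 'a set set" where
  "flats M = {F. F \<subseteq> ground M \<and> (\<forall>x\<in>ground M - F. rank_of M F < rank_of M (insert x F))}"

definition basis_of :: "'a indep_system \<Rightarrow> 'a set \<Rightarrow> 'a set \<Rightarrow> bool" where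
  "basis_of M A B \<longleftrightarrow> B \<subseteq> A \<and> indep M B \<and> (\<forall>C. B \<subseteq> C \<and> C \<subseteq> A \<and> indep M C \<longrightarrow> C = B)"

definition restriction :: "'a indep_system \<Rightarrow> 'a set \<Rightarrow> 'a indep_system" where
  "restriction M A = Indep_System (ground M \<inter> A) (\<lambda>I. I \<subseteq> A \<and> indep M I)"

definition contraction :: "'a indep_system \<Rightarrow> 'a set \<Rightarrow> 'a indep_system" where
  "contraction M A = Indep_System (ground M - A)
     (\<lambda>I. I \<subseteq> ground M - A \<and> (\<exists>B. basis_of M (ground M \<inter> A) B \<and> indep M (I \<union> B)))"

definition truncation :: "'a indep_system \<Rightarrow> 'a indep_system" where
  "truncation M = Indep_System (ground M) (\<lambda>I. indep M I \<and> card I \<le> rk M - 1)"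


section \<open>The characteristic polynomial\<close>

text \<open>The Moebius function of a family \<open>L\<close> of finite sets ordered by inclusion.\<close>

function mobius :: "'a set set \<Rightarrow> 'a set \<Rightarrow> 'a set \<Rightarrow> int" where
  "mobius L F G =
     (if F = G then 1
      else if F \<subset> G \<and> finite G then - (\<Sum>H\<in>{H \<in> L. F \<subseteq> H \<and> H \<subset> G}. mobius L F H)
      else 0)"
  by auto
termination
  by (relation "measure (\<lambda>(L, F, G). card G)") (auto intro: psubset_card_mono)

declare mobius.simps [simp del]

definition charpoly :: "'a indep_system \<Rightarrow> int poly" where
  "charpoly M = (\<Sum>F\<in>flats M. monom (mobius (flats M) {} F) (rk M - rank_of M F))"

text \<open>The division is exact for loopless \<open>M\<close> with \<open>rk M > 0\<close>.\<close>

definition reduced_charpoly :: "'a indep_system \<Rightarrow> int poly" where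
  "reduced_charpoly M = charpoly M div [:-1, 1:]"


section \<open>Rational functions in one variable\<close>

type_synonym ratfun = "rat poly fract"

definition ratfun_var :: ratfun where
  "ratfun_var = to_fract [:0, 1:]"

definition ratfun_deriv :: "ratfun \<Rightarrow> ratfun" where
  "ratfun_deriv q =
     (let (a, b) = quot_of_fract q in Fract (pderiv a * b - a * pderiv b) (b * b))"

lemma ratfun_deriv_Fract:
  assumes "b \<noteq> 0"
  shows "ratfun_deriv (Fract a b) = Fract (pderiv a * b - a * pderiv b) (b * b)"
proof -
  obtain c d where cd: "quot_of_fract (Fract a b) = (c, d)" by fastforce
  have "Fract c d = Fract a b" and d: "d \<noteq> 0"
    using Fract_quot_of_fract[of "Fract a b"] snd_quot_of_fract_nonzero[of "Fract a b"]
    by (simp_all add: cd)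
  then have eq: "a * d = c * b" using assms by (simp add: eq_fract)
  have "pderiv (a * d) = pderiv (c * b)" by (simp add: eq)
  then have eq': "a * pderiv d + d * pderiv a = c * pderiv b + b * pderiv c"
    by (simp add: pderiv_mult)
  have "(pderiv a * b - a * pderiv b) * (d * d) - (pderiv c * d - c * pderiv d) * (b * b) =
        b * d * ((a * pderiv d + d * pderiv a) - (c * pderiv b + b * pderiv c))
        - (a * d - c * b) * (b * pderiv d + d * pderiv b)"
    by (simp add: algebra_simps)
  also have "\<dots> = 0" by (simp add: eq eq')
  finally have "(pderiv a * b - a * pderiv b) * (d * d) = (pderiv c * d - c * pderiv d) * (b * b)"
    by simp
  then show ?thesis using assms d by (simp add: ratfun_deriv_def cd eq_fract)
qed

text \<open>The normalized representation is coprime, so a rational function has a pole at \<open>x\<close> iff its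
  normalized denominator vanishes there. The value at a pole is \<open>0\<close> by convention.\<close>

definition ratfun_pole :: "ratfun \<Rightarrow> rat \<Rightarrow> bool" where
  "ratfun_pole q x \<longleftrightarrow> poly (snd (quot_of_fract q)) x = 0"

definition ratfun_eval :: "ratfun \<Rightarrow> rat \<Rightarrow> rat" where
  "ratfun_eval q x = poly (fst (quot_of_fract q)) x / poly (snd (quot_of_fract q)) x"

lemma quot_of_fract_Fract_cases:
  fixes a b :: "rat poly"
  assumes "b \<noteq> 0"
  obtains d where "a = fst (quot_of_fract (Fract a b)) * d" "b = snd (quot_of_fract (Fract a b)) * d"
proof -
  have "quot_of_fract (Fract a b) = normalize_quot (a, b)"
    using quot_of_fract_quot_to_fract[of "(a, b)"] by (simp add: quot_to_fract_def)
  with normalize_quotE[OF assms, of a] that show thesis by metis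
qed

lemma ratfun_not_pole_Fract:
  assumes "poly b x \<noteq> 0"
  shows "\<not> ratfun_pole (Fract a b) x"
proof -
  have "b \<noteq> 0" using assms by auto
  then obtain d where "b = snd (quot_of_fract (Fract a b)) * d"
    by (rule quot_of_fract_Fract_cases)
  then have "poly b x = poly (snd (quot_of_fract (Fract a b))) x * poly d x"
    by (metis poly_mult)
  then show ?thesis using assms by (auto simp: ratfun_pole_def)
qed

lemma ratfun_eval_Fract:
  assumes "poly b x \<noteq> 0"
  shows "ratfun_eval (Fract a b) x = poly a x / poly b x"
proof -
  have "b \<noteq> 0" using assms by auto
  then obtain d where
    "a = fst (quot_of_fract (Fract a b)) * d" "b = snd (quot_of_fract (Fract a b)) * d"
    by (rule quot_of_fract_Fract_cases)
  then have "poly a x = poly (fst (quot_of_fract (Fract a b))) x * poly d x"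
    "poly b x = poly (snd (quot_of_fract (Fract a b))) x * poly d x"
    by (metis poly_mult)+
  then show ?thesis using assms by (simp add: ratfun_eval_def)
qed

lemma ratfun_not_poleE:
  assumes "\<not> ratfun_pole q x"
  obtains a b where "q = Fract a b" "b \<noteq> 0" "poly b x \<noteq> 0"
  using assms that[of "fst (quot_of_fract q)" "snd (quot_of_fract q)"]
  by (auto simp: ratfun_pole_def)

lemma ratfun_not_pole_add:
  "\<not> ratfun_pole p x \<Longrightarrow> \<not> ratfun_pole q x \<Longrightarrow> \<not> ratfun_pole (p + q) x"
  by (elim ratfun_not_poleE) (simp add: ratfun_not_pole_Fract)

lemma ratfun_not_pole_mult:
  "\<not> ratfun_pole p x \<Longrightarrow> \<not> ratfun_pole q x \<Longrightarrow> \<not> ratfun_pole (p * q) x"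
  by (elim ratfun_not_poleE) (simp add: ratfun_not_pole_Fract)

lemma ratfun_not_pole_deriv: "\<not> ratfun_pole q x \<Longrightarrow> \<not> ratfun_pole (ratfun_deriv q) x"
  by (elim ratfun_not_poleE) (simp add: ratfun_not_pole_Fract ratfun_deriv_Fract)

lemma ratfun_not_pole_to_fract: "\<not> ratfun_pole (to_fract p) x"
  by (simp add: ratfun_pole_def)

lemma ratfun_not_pole_sum:
  "(\<And>i. i \<in> A \<Longrightarrow> \<not> ratfun_pole (f i) x) \<Longrightarrow> \<not> ratfun_pole (sum f A) x"
  by (induction A rule: infinite_finite_induct)
     (simp_all add: ratfun_not_pole_add ratfun_not_pole_to_fract[of 0, simplified])


section \<open>The topological zeta function\<close>

text \<open>The finiteness test only serves termination. In rank \<open>0\<close> the value is \<open>1\<close> even in the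
  presence of loops, which covers the truncation of a matroid of rank \<open>1\<close>.\<close>

function ztop :: "'a indep_system \<Rightarrow> ratfun" where
  "ztop M =
     (if rk M = 0 \<or> infinite (ground M) then 1
      else 1 / (of_nat (card (ground M)) * ratfun_var + of_nat (rk M)) *
        (\<Sum>F\<in>flats M - {ground M}.
           ztop (restriction M F) * of_int (poly (reduced_charpoly (contraction M F)) 1)))"
  by auto
termination
  by (relation "measure (card \<circ> ground)")
     (auto simp: restriction_def flats_def intro!: psubset_card_mono)

declare ztop.simps [simp del]

lemma to_fract_of_nat: "to_fract (of_nat n) = of_nat n"
  by (induction n) simp_all

lemma to_fract_of_int: "to_fract (of_int n) = of_int n"
  by (cases n) (simp_all add: to_fract_of_nat)

lemma ztop_not_pole_0: "\<not> ratfun_pole (ztop M) 0"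
proof (induction M rule: ztop.induct)
  case (1 M)
  show ?case
  proof (cases "rk M = 0 \<or> infinite (ground M)")
    case True
    then show ?thesis using ratfun_not_pole_to_fract[of 1 0] by (simp add: ztop.simps)
  next
    case False
    define d where "d = of_nat (card (ground M)) * [:0, 1:] + (of_nat (rk M) :: rat poly)"
    have d: "of_nat (card (ground M)) * ratfun_var + of_nat (rk M) = to_fract d"
      by (simp only: d_def ratfun_var_def to_fract_of_nat to_fract_add to_fract_mult)
    have "poly d 0 \<noteq> 0" using False by (simp add: d_def)
    then have "\<not> ratfun_pole (1 / to_fract d) 0"
      by (simp add: ratfun_not_pole_Fract to_fract_def One_fract_def)
    moreover have "\<not> ratfun_pole (\<Sum>F\<in>flats M - {ground M}.
        ztop (restriction M F) * of_int (poly (reduced_charpoly (contraction M F)) 1)) 0"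
      using 1 False
      by (intro ratfun_not_pole_sum ratfun_not_pole_mult)
         (auto simp: ratfun_not_pole_to_fract simp flip: to_fract_of_int)
    ultimately show ?thesis
      unfolding ztop.simps[of M] d using False by (simp only: if_False ratfun_not_pole_mult simp_thms)
  qed
qed

end

theory Submission
  imports Defs
begin

text \<open>Write \<open>ztop (M|F)\<close> as the sum of \<open>w(G)\<close> over the flats \<open>G \<subseteq> F\<close>. Moebius inversion turns the
  defining recursion of \<open>ztop\<close> into
  \<open>(|F| s + rk F) w(F) = - s \<Sum> |F - H| w(H)\<close>, the sum running over the flats \<open>H\<close> covered by \<open>F\<close>,
  with \<open>w({}) = 1\<close>. In particular \<open>w(F)\<close> vanishes to order \<open>rk F\<close> at \<open>s = 0\<close>.

  The weights of flats of rank at most \<open>r - 2\<close> are the same in \<open>M\<close> and in its truncation \<open>T\<close>. Since the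
  flats covering \<open>H\<close> partition \<open>E - H\<close>, adding up the recursions of all \<open>F\<close> of rank \<open>r - 1\<close> gives
  the recursion for \<open>w\<^sub>T(E)\<close>, with the result
  \<open>(|E| s + r - 1) (\<Sum> w(F) - w\<^sub>T(E)) = s \<Sum> |E - F| w(F)\<close>, both sums over the flats of rank
  \<open>r - 1\<close>. So this difference, and with it the difference of the two zeta functions, vanishes to
  order \<open>r\<close> at \<open>s = 0\<close>.\<close>

section \<open>Moebius inversion\<close>

text \<open>The recursion defining \<open>mobius\<close> with the term \<open>H = G\<close> moved
  across; \<open>G \<in> L\<close> is what makes that term part of the sum.\<close>

lemma sum_mobius:
  assumes "finite G" "F \<subseteq> G" "G \<in> L"
  shows "(\<Sum>H\<in>{H \<in> L. F \<subseteq> H \<and> H \<subseteq> G}. mobius L F H) = (if F = G then 1 else 0)"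
proof (cases "F = G")
  case True
  then have "{H \<in> L. F \<subseteq> H \<and> H \<subseteq> G} = {G}" using assms by auto
  then show ?thesis using True by (simp add: mobius.simps)
next
  case False
  have eq: "{H \<in> L. F \<subseteq> H \<and> H \<subseteq> G} = insert G {H \<in> L. F \<subseteq> H \<and> H \<subset> G}"
    using assms by auto
  have fin: "finite {H \<in> L. F \<subseteq> H \<and> H \<subset> G}"
    by (rule finite_subset[of _ "Pow G"]) (use assms in auto)
  have "mobius L F G = - (\<Sum>H\<in>{H \<in> L. F \<subseteq> H \<and> H \<subset> G}. mobius L F H)"
    using assms False by (subst mobius.simps) auto
  then show ?thesis unfolding eq using fin False by simp
qed

text \<open>Let \<open>S F K\<close> be the sum below for the interval from \<open>F\<close> to \<open>K\<close>. By \<open>sum_mobius\<close>, summing \<open>S F K\<close>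
  over \<open>K \<subseteq> G\<close> gives \<open>1\<close> for every \<open>G\<close>, which forces \<open>S\<close> to be the identity of the
  incidence algebra.\<close>

lemma sum_mobius_dual:
  assumes "finite G" "F \<subseteq> G" "F \<in> L" "G \<in> L"
  shows "(\<Sum>H\<in>{H \<in> L. F \<subseteq> H \<and> H \<subseteq> G}. mobius L H G) = (if F = G then 1 else 0)"
  using assms(1,2,4)
proof (induction G rule: finite_psubset_induct)
  case (psubset G)
  let ?S = "\<lambda>K. \<Sum>H\<in>{H \<in> L. F \<subseteq> H \<and> H \<subseteq> K}. mobius L H K"
  let ?I = "{H \<in> L. F \<subseteq> H \<and> H \<subseteq> G}"
  have fin: "finite ?I"
    by (rule finite_subset[of _ "Pow G"]) (use psubset in auto)
  have "(\<Sum>K\<in>?I. ?S K) = (\<Sum>K\<in>?I. \<Sum>H\<in>{H \<in> ?I. H \<subseteq> K}. mobius L H K)"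
    by (intro sum.cong) auto
  also have "\<dots> = (\<Sum>H\<in>?I. \<Sum>K\<in>{K \<in> ?I. H \<subseteq> K}. mobius L H K)"
    by (rule sum.swap_restrict[OF fin fin])
  also have "\<dots> = (\<Sum>H\<in>?I. if H = G then 1 else 0)"
  proof (rule sum.cong)
    fix H assume H: "H \<in> ?I"
    then have "{K \<in> ?I. H \<subseteq> K} = {K \<in> L. H \<subseteq> K \<and> K \<subseteq> G}" by auto
    then show "(\<Sum>K\<in>{K \<in> ?I. H \<subseteq> K}. mobius L H K) = (if H = G then 1 else 0)"
      using sum_mobius[of G H L] H psubset by simp
  qed simp
  also have "\<dots> = 1" using fin psubset by (simp add: sum.delta)
  finally have total: "(\<Sum>K\<in>?I. ?S K) = 1" .
  have "(\<Sum>K\<in>?I. ?S K) = ?S G + (\<Sum>K\<in>?I - {G}. ?S K)"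
    using fin psubset by (intro sum.remove) auto
  also have "(\<Sum>K\<in>?I - {G}. ?S K) = (\<Sum>K\<in>?I - {G}. if K = F then 1 else 0)"
  proof (rule sum.cong)
    fix K assume "K \<in> ?I - {G}"
    then have "?S K = (if F = K then 1 else 0)"
      using psubset.IH[of K] by blast
    then show "?S K = (if K = F then 1 else 0)"
      by (simp only: eq_commute[of F K])
  qed simp
  also have "\<dots> = (if F = G then 0 else 1)"
    using fin assms(3) psubset.prems by (auto simp: sum.delta)
  finally show ?case using total by (auto split: if_splits)
qed

text \<open>On members of \<open>L\<close> containing \<open>A\<close>, removing \<open>A\<close> is
  injective and preserves and reflects strict inclusion, so the recursion is carried over term by
  term. The flats of a contraction have this form.\<close>

lemma mobius_diff_image:
  assumes "finite G" "A \<subseteq> G"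
  shows "mobius ((\<lambda>G. G - A) ` {G \<in> L. A \<subseteq> G}) {} (G - A) = mobius L A G"
  using assms
proof (induction G rule: finite_psubset_induct)
  case (psubset G)
  let ?L = "(\<lambda>G. G - A) ` {G \<in> L. A \<subseteq> G}"
  show ?case
  proof (cases "A = G")
    case True
    then show ?thesis by (simp add: mobius.simps)
  next
    case False
    let ?I = "{H \<in> L. A \<subseteq> H \<and> H \<subset> G}"
    have img: "{H \<in> ?L. {} \<subseteq> H \<and> H \<subset> G - A} = (\<lambda>H. H - A) ` ?I"
    proof (intro equalityI subsetI)
      fix X assume "X \<in> {H \<in> ?L. {} \<subseteq> H \<and> H \<subset> G - A}"
      then obtain H where H: "H \<in> L" "A \<subseteq> H" "X = H - A" "H - A \<subset> G - A" by blast
      then have "H \<subset> G" using psubset.prems by blast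
      then show "X \<in> (\<lambda>H. H - A) ` ?I" using H by blast
    next
      fix X assume "X \<in> (\<lambda>H. H - A) ` ?I"
      then obtain H where H: "H \<in> L" "A \<subseteq> H" "H \<subset> G" "X = H - A" by blast
      then have "H - A \<subset> G - A" by blast
      then show "X \<in> {H \<in> ?L. {} \<subseteq> H \<and> H \<subset> G - A}" using H by blast
    qed
    have inj: "inj_on (\<lambda>H. H - A) ?I"
      by (auto simp: inj_on_def)
    have "mobius ?L {} (G - A) = - (\<Sum>H\<in>{H \<in> ?L. {} \<subseteq> H \<and> H \<subset> G - A}. mobius ?L {} H)"
      using False psubset by (subst mobius.simps) auto
    also have "\<dots> = - (\<Sum>H\<in>?I. mobius ?L {} (H - A))"
      unfolding img by (simp add: sum.reindex[OF inj])
    also have "\<dots> = - (\<Sum>H\<in>?I. mobius L A H)"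
      using psubset.IH by (intro arg_cong[of _ _ uminus] sum.cong) auto
    also have "\<dots> = mobius L A G"
      using False psubset by (subst (2) mobius.simps) auto
    finally show ?thesis .
  qed
qed

section \<open>Rank and flats\<close>

context
  fixes M :: "'a indep_system"
  assumes M: "matroid M"
begin

lemma finite_ground: "finite (ground M)"
  and indep_subset_ground: "indep M I \<Longrightarrow> I \<subseteq> ground M"
  and indep_empty: "indep M {}"
  and indep_subset: "indep M I \<Longrightarrow> J \<subseteq> I \<Longrightarrow> indep M J"
  and indep_augment: "indep M I \<Longrightarrow> indep M J \<Longrightarrow> card I < card J \<Longrightarrow> \<exists>x\<in>J - I. indep M (insert x I)"
  using M unfolding matroid_def by blast+

lemma indep_finite: "indep M I \<Longrightarrow> finite I"
  using indep_subset_ground finite_ground finite_subset by blast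

lemma finite_flats: "finite (flats M)"
  by (rule finite_subset[of _ "Pow (ground M)"]) (auto simp: flats_def finite_ground)

lemma flats_subset_ground: "F \<in> flats M \<Longrightarrow> F \<subseteq> ground M"
  by (simp add: flats_def)

lemma finite_flat: "F \<in> flats M \<Longrightarrow> finite F"
  using flats_subset_ground finite_ground finite_subset by blast

lemma finite_indep_cards: "finite {card I | I. I \<subseteq> A \<and> indep M I}"
  by (rule finite_subset[of _ "{..card (ground M)}"])
     (auto intro!: card_mono finite_ground dest!: indep_subset_ground)

lemma card_indep_le_rank_of: "I \<subseteq> A \<Longrightarrow> indep M I \<Longrightarrow> card I \<le> rank_of M A"
  unfolding rank_of_def by (rule Max_ge[OF finite_indep_cards]) auto

lemma rank_of_witness: "\<exists>I. I \<subseteq> A \<and> indep M I \<and> card I = rank_of M A"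
proof -
  have "rank_of M A \<in> {card I | I. I \<subseteq> A \<and> indep M I}"
    unfolding rank_of_def using indep_empty by (intro Max_in finite_indep_cards) auto
  then show ?thesis by auto
qed

text \<open>Repeated augmentation from a largest independent subset of \<open>A\<close>; the
  induction counts the elements still missing.\<close>

lemma indep_extend:
  assumes "I \<subseteq> A" "indep M I"
  shows "\<exists>J. I \<subseteq> J \<and> J \<subseteq> A \<and> indep M J \<and> card J = rank_of M A"
  using assms
proof (induction "rank_of M A - card I" arbitrary: I)
  case 0
  then show ?case using card_indep_le_rank_of[of I A] by auto
next
  case (Suc k)
  obtain J where J: "J \<subseteq> A" "indep M J" "card J = rank_of M A" using rank_of_witness by blast
  have "card I < card J" using Suc.hyps(2) J by linarith
  then obtain x where x: "x \<in> J - I" "indep M (insert x I)"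
    using indep_augment[of I J] Suc.prems J by blast
  then have "k = rank_of M A - card (insert x I)"
    using Suc indep_finite[of I] by simp
  then obtain K where "insert x I \<subseteq> K" "K \<subseteq> A" "indep M K" "card K = rank_of M A"
    using Suc(1)[of "insert x I"] x J Suc.prems by blast
  then show ?case by blast
qed

lemma rank_of_mono: "A \<subseteq> B \<Longrightarrow> rank_of M A \<le> rank_of M B"
  using rank_of_witness[of A] card_indep_le_rank_of[of _ B] by (metis order_trans)

lemma rank_of_insert_ge: "rank_of M A \<le> rank_of M (insert x A)"
  by (rule rank_of_mono) blast

lemma rank_of_insert_le: "rank_of M (insert x A) \<le> Suc (rank_of M A)"
proof -
  obtain I where I: "I \<subseteq> insert x A" "indep M I" "card I = rank_of M (insert x A)"
    using rank_of_witness by blast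
  then have "card (I - {x}) \<le> rank_of M A"
    by (intro card_indep_le_rank_of indep_subset[OF I(2)]) auto
  moreover have "card I \<le> Suc (card (I - {x}))" by (simp add: card_Diff_singleton_if) linarith
  ultimately show ?thesis using I by linarith
qed

text \<open>A largest independent set \<open>I\<close> of \<open>A\<close> grows to \<open>J\<close>
  in \<open>B\<close> and then to \<open>K\<close> in \<open>insert x B\<close>. If the rank of
  \<open>B\<close> rose, \<open>K\<close> would contain \<open>x\<close>, and
  \<open>insert x I\<close>, a subset of \<open>K\<close>, would be too large for
  \<open>insert x A\<close>. Monotonicity of closure rests on this.\<close>

lemma rank_of_insert_eq_mono:
  assumes "rank_of M (insert x A) = rank_of M A" "A \<subseteq> B"
  shows "rank_of M (insert x B) = rank_of M B"
proof (rule ccontr)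
  assume neq: "rank_of M (insert x B) \<noteq> rank_of M B"
  then have lt: "rank_of M B < rank_of M (insert x B)"
    using rank_of_insert_ge[of B x] by linarith
  have "x \<notin> B" using neq by (metis insert_absorb)
  obtain I where I: "I \<subseteq> A" "indep M I" "card I = rank_of M A" using rank_of_witness by blast
  then obtain J where J: "I \<subseteq> J" "J \<subseteq> B" "indep M J" "card J = rank_of M B"
    using indep_extend[of I B] assms(2) by blast
  then obtain K where K: "J \<subseteq> K" "K \<subseteq> insert x B" "indep M K" "card K = rank_of M (insert x B)"
    using indep_extend[of J "insert x B"] by blast
  have "x \<in> K" using K card_indep_le_rank_of[of K B] lt subset_insert[of x K B] by linarith
  then have "indep M (insert x I)" using K J by (intro indep_subset[OF K(3)]) auto
  then have "card (insert x I) \<le> rank_of M A"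
    using I assms(1) card_indep_le_rank_of[of "insert x I" "insert x A"] by auto
  moreover have "x \<notin> I" using \<open>x \<notin> B\<close> I assms(2) by blast
  ultimately show False using I indep_finite[of I] by simp
qed

lemma rank_of_Un_eq:
  assumes "finite X" "\<And>x. x \<in> X \<Longrightarrow> rank_of M (insert x A) = rank_of M A"
  shows "rank_of M (A \<union> X) = rank_of M A"
  using assms
proof (induction X)
  case (insert x X)
  then show ?case using rank_of_insert_eq_mono[of x A "A \<union> X"] by simp
qed simp

lemma rank_of_empty: "rank_of M {} = 0"
proof -
  have "{card I | I. I \<subseteq> {} \<and> indep M I} = {0}" using indep_empty by auto
  then show ?thesis by (simp add: rank_of_def)
qed

lemma rank_of_insert_flat:
  "F \<in> flats M \<Longrightarrow> x \<in> ground M - F \<Longrightarrow> rank_of M (insert x F) = Suc (rank_of M F)"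
  by (rule le_antisym[OF rank_of_insert_le]) (simp add: flats_def Suc_le_eq)

lemma rank_of_less_flat:
  assumes "F \<in> flats M" "F \<subset> G" "G \<subseteq> ground M"
  shows "rank_of M F < rank_of M G"
proof -
  obtain x where "x \<in> G - F" using assms by blast
  then have "rank_of M F < rank_of M (insert x F)" using assms by (auto simp: flats_def)
  also have "\<dots> \<le> rank_of M G" using assms \<open>x \<in> G - F\<close> by (intro rank_of_mono) auto
  finally show ?thesis .
qed

lemma ground_in_flats: "ground M \<in> flats M"
  by (simp add: flats_def)

lemma rank_of_le_rk: "A \<subseteq> ground M \<Longrightarrow> rank_of M A \<le> rk M"
  by (simp add: rk_def rank_of_mono)

text \<open>The closure consists of \<open>A\<close> and the elements that leave its rank unchanged.
  Adding them all at once keeps the rank, by \<open>rank_of_Un_eq\<close>, and a flat above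
  \<open>A\<close> contains each of them, by \<open>rank_of_insert_eq_mono\<close>.\<close>

lemma closure_flatE:
  assumes "A \<subseteq> ground M"
  obtains C where "C \<in> flats M" "A \<subseteq> C" "rank_of M C = rank_of M A"
    "\<And>G. G \<in> flats M \<Longrightarrow> A \<subseteq> G \<Longrightarrow> C \<subseteq> G"
proof -
  let ?F = "A \<union> {x \<in> ground M. rank_of M (insert x A) = rank_of M A}"
  have rank: "rank_of M ?F = rank_of M A"
    by (rule rank_of_Un_eq) (auto simp: finite_ground)
  have "?F \<in> flats M"
    unfolding flats_def
  proof (intro CollectI conjI ballI)
    fix x assume "x \<in> ground M - ?F"
    then have "rank_of M A \<noteq> rank_of M (insert x A)" by (metis (mono_tags, lifting) DiffE UnCI mem_Collect_eq)
    then have "rank_of M A < rank_of M (insert x A)"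
      using rank_of_insert_ge[of A x] by linarith
    also have "\<dots> \<le> rank_of M (insert x ?F)" by (rule rank_of_mono) auto
    finally show "rank_of M ?F < rank_of M (insert x ?F)" using rank by simp
  qed (use assms in auto)
  moreover have "?F \<subseteq> G" if "G \<in> flats M" "A \<subseteq> G" for G
  proof
    fix x assume "x \<in> ?F"
    then consider "x \<in> A" | "x \<in> ground M" "rank_of M (insert x A) = rank_of M A" by blast
    then show "x \<in> G"
    proof cases
      case 2
      then have "rank_of M (insert x G) = rank_of M G"
        using rank_of_insert_eq_mono[of x A G] that by blast
      then show ?thesis using rank_of_insert_flat[of G x] that 2 by fastforce
    qed (use that in blast)
  qed
  ultimately show ?thesis using rank by (intro that[of ?F]) blast+
qed

lemma flat_eqI:
  assumes "F \<in> flats M" "F \<subseteq> G" "G \<subseteq> ground M" "rank_of M G = rank_of M F"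
  shows "F = G"
  using rank_of_less_flat[of F G] assms by (metis order_less_irrefl psubsetI)

text \<open>Each \<open>x \<in> F - K\<close> lies in exactly one cover of \<open>K\<close>, the
  closure of \<open>insert x K\<close>: the closure stays inside the flat \<open>F\<close>, and any
  cover containing \<open>x\<close> contains it and has the same rank.\<close>

lemma card_diff_eq_sum_covers:
  assumes "K \<in> flats M" "F \<in> flats M" "K \<subseteq> F"
  shows "card (F - K) =
    (\<Sum>H\<in>{H \<in> flats M. K \<subseteq> H \<and> H \<subseteq> F \<and> rank_of M H = Suc (rank_of M K)}. card (H - K))"
proof -
  let ?C = "{H \<in> flats M. K \<subseteq> H \<and> H \<subseteq> F \<and> rank_of M H = Suc (rank_of M K)}"
  note rank_ins = rank_of_insert_flat[OF assms(1)]
  have "F - K = (\<Union>H\<in>?C. H - K)"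
  proof
    show "F - K \<subseteq> (\<Union>H\<in>?C. H - K)"
    proof
      fix x assume x: "x \<in> F - K"
      then have xg: "x \<in> ground M - K" and sub: "insert x K \<subseteq> ground M" "insert x K \<subseteq> F"
        using assms flats_subset_ground by blast+
      obtain H where H: "H \<in> flats M" "insert x K \<subseteq> H" "rank_of M H = rank_of M (insert x K)"
        and "\<And>G. G \<in> flats M \<Longrightarrow> insert x K \<subseteq> G \<Longrightarrow> H \<subseteq> G"
        using closure_flatE[OF sub(1)] by blast
      then have "H \<subseteq> F" using assms(2) sub(2) by blast
      then have "H \<in> ?C" using H rank_ins[OF xg] by simp
      then show "x \<in> (\<Union>H\<in>?C. H - K)" using H x by blast
    qed
  qed auto
  moreover have "card (\<Union>H\<in>?C. H - K) = (\<Sum>H\<in>?C. card (H - K))"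
  proof (rule card_UN_disjoint)
    show "finite ?C" using finite_flats by simp
    show "\<forall>H\<in>?C. finite (H - K)" using finite_flat by simp
    show "\<forall>H\<in>?C. \<forall>H'\<in>?C. H \<noteq> H' \<longrightarrow> (H - K) \<inter> (H' - K) = {}"
    proof (intro ballI impI, rule ccontr)
      fix H H' assume H: "H \<in> ?C" and H': "H' \<in> ?C" and "H \<noteq> H'"
      assume "(H - K) \<inter> (H' - K) \<noteq> {}"
      then obtain x where x: "x \<in> H - K" "x \<in> H' - K" by auto
      then have xg: "x \<in> ground M - K" and sub: "insert x K \<subseteq> ground M"
        using H assms(1) flats_subset_ground by blast+
      obtain C where C: "C \<in> flats M" "rank_of M C = rank_of M (insert x K)"
        and least: "\<And>G. G \<in> flats M \<Longrightarrow> insert x K \<subseteq> G \<Longrightarrow> C \<subseteq> G"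
        using closure_flatE[OF sub] by blast
      have "C = G" if "G \<in> ?C" "x \<in> G" for G
      proof (rule flat_eqI)
        show "C \<subseteq> G" using that least[of G] by blast
        show "rank_of M G = rank_of M C" using that C rank_ins[OF xg] by simp
      qed (use that C flats_subset_ground in auto)
      then show False using H H' x \<open>H \<noteq> H'\<close> by blast
    qed
  qed
  ultimately show ?thesis by simp
qed

lemma empty_in_flats:
  assumes "loopless M"
  shows "{} \<in> flats M"
proof -
  have "0 < rank_of M {x}" if "x \<in> ground M" for x
    using card_indep_le_rank_of[of "{x}" "{x}"] assms that by (simp add: loopless_def)
  then show ?thesis by (simp add: flats_def rank_of_empty)
qed

lemma flat_rank_0:
  assumes "loopless M" "F \<in> flats M" "rank_of M F = 0"
  shows "F = {}"
  using flat_eqI[of "{}" F] assms empty_in_flats by (simp add: rank_of_empty flats_subset_ground)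

section \<open>Contraction, restriction and truncation\<close>

text \<open>Maximality under inclusion agrees with maximum size because every independent subset of
  \<open>A\<close> extends to one of size \<open>rank_of M A\<close>.\<close>

lemma basis_of_iff: "basis_of M A B \<longleftrightarrow> B \<subseteq> A \<and> indep M B \<and> card B = rank_of M A"
proof
  assume B: "basis_of M A B"
  then obtain C where "B \<subseteq> C" "C \<subseteq> A" "indep M C" "card C = rank_of M A"
    using indep_extend[of B A] unfolding basis_of_def by blast
  with B show "B \<subseteq> A \<and> indep M B \<and> card B = rank_of M A" unfolding basis_of_def by blast
next
  assume B: "B \<subseteq> A \<and> indep M B \<and> card B = rank_of M A"
  have "C = B" if "B \<subseteq> C" "C \<subseteq> A" "indep M C" for C
    using card_seteq[of C B] indep_finite[OF that(3)] card_indep_le_rank_of[OF that(2,3)] that(1) B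
    by simp
  with B show "basis_of M A B" unfolding basis_of_def by blast
qed

text \<open>An independent set of the contraction together with a suitable basis of \<open>F\<close>
  is independent in \<open>A \<union> F\<close>, which bounds its size. Conversely, a basis
  \<open>B\<close> of \<open>F\<close> extends to a largest independent set \<open>K\<close> of
  \<open>A \<union> F\<close>, and \<open>K - B\<close> attains the bound.\<close>

lemma rank_of_contraction:
  assumes "F \<subseteq> ground M" "A \<subseteq> ground M - F"
  shows "rank_of (contraction M F) A = rank_of M (A \<union> F) - rank_of M F"
proof -
  let ?S = "{card I | I. I \<subseteq> A \<and> indep (contraction M F) I}"
  have ind: "indep (contraction M F) I \<longleftrightarrow> I \<subseteq> ground M - F \<and>
      (\<exists>B. B \<subseteq> F \<and> indep M B \<and> card B = rank_of M F \<and> indep M (I \<union> B))" for I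
    using assms(1) by (simp add: contraction_def basis_of_iff Int_absorb1 conj_assoc)
  have le: "card I \<le> rank_of M (A \<union> F) - rank_of M F"
    if I: "I \<subseteq> A" "indep (contraction M F) I" for I
  proof -
    obtain B where B: "I \<subseteq> ground M - F" "B \<subseteq> F" "card B = rank_of M F" "indep M (I \<union> B)"
      using I(2) unfolding ind by blast
    have "finite (I \<union> B)" using B indep_finite by blast
    moreover have "I \<inter> B = {}" using B by blast
    ultimately have "card (I \<union> B) = card I + card B" by (intro card_Un_disjoint) auto
    moreover have "card (I \<union> B) \<le> rank_of M (A \<union> F)"
      using B I by (intro card_indep_le_rank_of) auto
    ultimately show ?thesis using B by simp
  qed
  have ex: "rank_of M (A \<union> F) - rank_of M F \<in> ?S"
  proof -
    obtain B where B: "B \<subseteq> F" "indep M B" "card B = rank_of M F" using rank_of_witness by blast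
    then obtain K where K: "B \<subseteq> K" "K \<subseteq> A \<union> F" "indep M K" "card K = rank_of M (A \<union> F)"
      using indep_extend[of B "A \<union> F"] by blast
    \<comment> \<open>\<open>K \<inter> F\<close> is independent and contains \<open>B\<close>,
      which already has the largest size possible in \<open>F\<close>.\<close>
    have "card (K \<inter> F) \<le> card B"
      unfolding B(3) by (intro card_indep_le_rank_of indep_subset[OF K(3)]) auto
    then have KB: "K \<inter> F = B"
      using B K indep_finite[of K] card_seteq[of "K \<inter> F" B] by auto
    have "indep (contraction M F) (K - B)"
      unfolding ind
    proof (intro conjI exI[of _ B])
      show "K - B \<subseteq> ground M - F" using K KB assms by blast
      have "K - B \<union> B = K" using K by blast
      then show "indep M (K - B \<union> B)" using K by simp
    qed (use B in auto)
    moreover have "K - B \<subseteq> A" using K KB by blast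
    moreover have "card (K - B) = rank_of M (A \<union> F) - rank_of M F"
      using B K indep_finite[of B] by (simp add: card_Diff_subset)
    ultimately show ?thesis by (metis (mono_tags, lifting) mem_Collect_eq)
  qed
  show ?thesis
    unfolding rank_of_def[of "contraction M F"]
  proof (rule Max_eqI)
    show "finite ?S"
      by (rule finite_subset[of _ "{..rank_of M (A \<union> F) - rank_of M F}"]) (use le in auto)
  qed (use le ex in auto)
qed

text \<open>Ranks in the contraction are ranks in \<open>M\<close> shifted by
  \<open>rank_of M F\<close>, so \<open>A\<close> is a flat there iff \<open>A \<union> F\<close> is
  a flat of \<open>M\<close>.\<close>

lemma flats_contraction:
  assumes "F \<in> flats M"
  shows "flats (contraction M F) = (\<lambda>G. G - F) ` {G \<in> flats M. F \<subseteq> G}"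
proof -
  have F: "F \<subseteq> ground M" using assms by (rule flats_subset_ground)
  have g: "ground (contraction M F) = ground M - F" by (simp add: contraction_def)
  have iff: "A \<in> flats (contraction M F) \<longleftrightarrow> A \<union> F \<in> flats M" if A: "A \<subseteq> ground M - F" for A
  proof -
    have "rank_of (contraction M F) A < rank_of (contraction M F) (insert x A) \<longleftrightarrow>
        rank_of M (A \<union> F) < rank_of M (insert x (A \<union> F))" if "x \<in> ground M - (A \<union> F)" for x
      using rank_of_contraction[OF F A] rank_of_contraction[OF F, of "insert x A"] that A
        rank_of_mono[of F "A \<union> F"] rank_of_mono[of F "insert x (A \<union> F)"] by auto
    moreover have "ground M - F - A = ground M - (A \<union> F)" by auto
    ultimately show ?thesis unfolding flats_def g using A F by auto
  qed
  show ?thesis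
  proof (intro equalityI subsetI)
    fix A assume A: "A \<in> flats (contraction M F)"
    then have "A \<subseteq> ground M - F" by (simp add: flats_def g)
    then have "A \<union> F \<in> flats M" "A = A \<union> F - F" using A iff by auto
    then show "A \<in> (\<lambda>G. G - F) ` {G \<in> flats M. F \<subseteq> G}" by blast
  next
    fix A assume "A \<in> (\<lambda>G. G - F) ` {G \<in> flats M. F \<subseteq> G}"
    then obtain G where G: "G \<in> flats M" "F \<subseteq> G" "A = G - F" by blast
    then have "A \<subseteq> ground M - F" "A \<union> F = G" using flats_subset_ground by blast+
    then show "A \<in> flats (contraction M F)" using iff G by simp
  qed
qed

section \<open>Characteristic polynomials of contractions and their values at 1\<close>

lemma charpoly_contraction:
  assumes "F \<in> flats M"
  shows "charpoly (contraction M F) =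
    (\<Sum>G\<in>{G \<in> flats M. F \<subseteq> G}. monom (mobius (flats M) F G) (rk M - rank_of M G))"
proof -
  have F: "F \<subseteq> ground M" using assms by (rule flats_subset_ground)
  have inj: "inj_on (\<lambda>G. G - F) {G \<in> flats M. F \<subseteq> G}" by (auto simp: inj_on_def)
  have Un: "ground M - F \<union> F = ground M" using F by blast
  have rk: "rk (contraction M F) = rk M - rank_of M F"
    using rank_of_contraction[OF F, of "ground M - F"] Un
    by (simp add: rk_def contraction_def)
  have "rank_of (contraction M F) (G - F) = rank_of M G - rank_of M F"
    if "G \<in> flats M" "F \<subseteq> G" for G
    using rank_of_contraction[OF F, of "G - F"] that flats_subset_ground[OF that(1)]
    by (simp add: Diff_mono Un_absorb2)
  \<comment> \<open>The shifts by \<open>rank_of M F\<close> cancel in the exponents.\<close>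
  then show ?thesis
    unfolding charpoly_def flats_contraction[OF assms] sum.reindex[OF inj] o_def rk
    by (intro sum.cong)
       (auto simp: mobius_diff_image finite_flat rank_of_mono)
qed

text \<open>The characteristic polynomial vanishes at \<open>1\<close>, so its quotient by
  \<open>x - 1\<close> takes there the value of the derivative, and differentiation turns the
  exponents into factors.\<close>

lemma reduced_charpoly_contraction_at_1:
  assumes "F \<in> flats M" "F \<noteq> ground M"
  shows "poly (reduced_charpoly (contraction M F)) 1 =
    (\<Sum>G\<in>{G \<in> flats M. F \<subseteq> G}. mobius (flats M) F G * int (rk M - rank_of M G))"
proof -
  let ?p = "charpoly (contraction M F)"
  have "poly ?p 1 = (\<Sum>G\<in>{G \<in> flats M. F \<subseteq> G}. mobius (flats M) F G)"
    by (simp add: charpoly_contraction[OF assms(1)] poly_sum poly_monom)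
  also have "\<dots> = (\<Sum>G\<in>{G \<in> flats M. F \<subseteq> G \<and> G \<subseteq> ground M}. mobius (flats M) F G)"
    by (intro sum.cong) (auto simp: flats_def)
  also have "\<dots> = 0"
    using sum_mobius[of "ground M" F "flats M"] assms
    by (simp add: finite_ground flats_subset_ground ground_in_flats)
  finally obtain q where q: "?p = [:-1, 1:] * q"
    by (auto simp: poly_eq_0_iff_dvd dvd_def)
  then have "reduced_charpoly (contraction M F) = q"
    unfolding reduced_charpoly_def by (metis nonzero_mult_div_cancel_left pCons_eq_0_iff one_neq_zero)
  then have "poly (reduced_charpoly (contraction M F)) 1 = poly (pderiv ?p) 1"
    unfolding q pderiv_mult by (simp add: pderiv_pCons)
  also have "\<dots> = (\<Sum>G\<in>{G \<in> flats M. F \<subseteq> G}. mobius (flats M) F G * int (rk M - rank_of M G))"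
    by (simp add: charpoly_contraction[OF assms(1)] higher_pderiv_sum[of 1, simplified] poly_sum pderiv_monom poly_monom
        mult.commute)
  finally show ?thesis .
qed

text \<open>After exchanging the sums, each \<open>G\<close> carries the sum of
  \<open>mobius (flats M) F G\<close> over \<open>H \<subseteq> F \<subseteq> G\<close>, and
  \<open>sum_mobius_dual\<close> keeps only \<open>G = H\<close>. This removes the characteristic
  polynomials from the recursion of \<open>ztop\<close>.\<close>

lemma sum_reduced_charpoly_at_1:
  assumes "H \<in> flats M"
  shows "(\<Sum>F\<in>{F \<in> flats M - {ground M}. H \<subseteq> F}. poly (reduced_charpoly (contraction M F)) 1) =
    int (rk M - rank_of M H)"
proof -
  let ?b = "\<lambda>F. \<Sum>G\<in>{G \<in> flats M. F \<subseteq> G}. mobius (flats M) F G * int (rk M - rank_of M G)"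
  let ?U = "{F \<in> flats M. H \<subseteq> F}"
  have fin: "finite ?U" using finite_flats by simp
  \<comment> \<open>\<open>?b\<close> vanishes at \<open>ground M\<close>, so this flat can be added
    and \<open>F\<close> then ranges over all flats above \<open>H\<close>.\<close>
  have "{G \<in> flats M. ground M \<subseteq> G} = {ground M}"
    using ground_in_flats flats_subset_ground by blast
  then have b_ground: "?b (ground M) = 0" by (simp add: rk_def)
  have "(\<Sum>F\<in>{F \<in> flats M - {ground M}. H \<subseteq> F}. poly (reduced_charpoly (contraction M F)) 1) =
      (\<Sum>F\<in>{F \<in> flats M - {ground M}. H \<subseteq> F}. ?b F)"
    by (intro sum.cong refl reduced_charpoly_contraction_at_1) auto
  also have "\<dots> = (\<Sum>F\<in>?U. ?b F)"
    using b_ground finite_flats by (intro sum.mono_neutral_left) auto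
  also have "\<dots> = (\<Sum>F\<in>?U. \<Sum>G\<in>{G \<in> ?U. F \<subseteq> G}. mobius (flats M) F G * int (rk M - rank_of M G))"
    by (intro sum.cong) auto
  also have "\<dots> = (\<Sum>G\<in>?U. \<Sum>F\<in>{F \<in> ?U. F \<subseteq> G}. mobius (flats M) F G * int (rk M - rank_of M G))"
    by (rule sum.swap_restrict[OF fin fin])
  also have "\<dots> = (\<Sum>G\<in>?U. if G = H then int (rk M - rank_of M G) else 0)"
  proof (rule sum.cong)
    fix G assume G: "G \<in> ?U"
    have "{F \<in> ?U. F \<subseteq> G} = {F \<in> flats M. H \<subseteq> F \<and> F \<subseteq> G}" by auto
    then show "(\<Sum>F\<in>{F \<in> ?U. F \<subseteq> G}. mobius (flats M) F G * int (rk M - rank_of M G)) =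
        (if G = H then int (rk M - rank_of M G) else 0)"
      using sum_mobius_dual[of G H "flats M"] G assms finite_flat
      by (simp flip: sum_distrib_right)
  qed simp
  also have "\<dots> = int (rk M - rank_of M H)"
    using fin assms by simp
  finally show ?thesis .
qed

section \<open>Restriction\<close>

lemma rank_of_restriction: "A \<subseteq> F \<Longrightarrow> rank_of (restriction M F) A = rank_of M A"
proof -
  assume "A \<subseteq> F"
  then have "I \<subseteq> A \<and> indep (restriction M F) I \<longleftrightarrow> I \<subseteq> A \<and> indep M I" for I
    by (auto simp: restriction_def)
  then show ?thesis by (simp add: rank_of_def)
qed

lemma matroid_restriction: "matroid (restriction M F)"
  unfolding matroid_def
proof (intro conjI allI impI)
  fix I J assume "indep (restriction M F) I" "J \<subseteq> I"
  then show "indep (restriction M F) J"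
    using indep_subset[of I J] by (auto simp: restriction_def)
next
  fix I J assume "indep (restriction M F) I" "indep (restriction M F) J" "card I < card J"
  then show "\<exists>x\<in>J - I. indep (restriction M F) (insert x I)"
    using indep_augment[of I J] by (auto simp: restriction_def)
qed (use indep_subset_ground in \<open>auto simp: restriction_def finite_ground indep_empty\<close>)

lemma loopless_restriction: "loopless M \<Longrightarrow> loopless (restriction M F)"
  by (auto simp: loopless_def restriction_def)

text \<open>An element outside the flat \<open>F\<close> raises the rank of \<open>F\<close> and
  hence, by \<open>rank_of_insert_eq_mono\<close>, of each subset of \<open>F\<close>. So being a
  flat is decided inside \<open>F\<close>.\<close>

lemma flats_restriction:
  assumes "F \<in> flats M"
  shows "flats (restriction M F) = {G \<in> flats M. G \<subseteq> F}"
proof -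
  have g: "ground (restriction M F) = F"
    using flats_subset_ground[OF assms] by (auto simp: restriction_def)
  have out: "rank_of M G < rank_of M (insert x G)"
    if "G \<subseteq> F" "x \<in> ground M - F" for G x
  proof -
    have "rank_of M (insert x F) \<noteq> rank_of M F"
      using rank_of_insert_flat[OF assms that(2)] by simp
    then have "rank_of M (insert x G) \<noteq> rank_of M G"
      using rank_of_insert_eq_mono[of x G F] that by auto
    then show ?thesis using rank_of_insert_ge[of G x] by linarith
  qed
  have "G \<in> flats (restriction M F) \<longleftrightarrow> G \<in> flats M" if "G \<subseteq> F" for G
  proof -
    have "G \<in> flats (restriction M F) \<longleftrightarrow> (\<forall>x\<in>F - G. rank_of M G < rank_of M (insert x G))"
      using that by (simp add: flats_def g rank_of_restriction)
    also have "\<dots> \<longleftrightarrow> (\<forall>x\<in>ground M - G. rank_of M G < rank_of M (insert x G))"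
      using out[OF that] flats_subset_ground[OF assms] that by blast
    also have "\<dots> \<longleftrightarrow> G \<in> flats M"
      using order_trans[OF that flats_subset_ground[OF assms]] by (simp add: flats_def)
    finally show ?thesis .
  qed
  moreover have "G \<subseteq> F" if "G \<in> flats (restriction M F)" for G
    using that by (simp add: flats_def g)
  ultimately show ?thesis by blast
qed

section \<open>Truncation\<close>

lemma matroid_truncation: "matroid (truncation M)"
  unfolding matroid_def
proof (intro conjI allI impI)
  fix I J assume IJ: "indep (truncation M) I" "indep (truncation M) J" "card I < card J"
  then have "finite I" using indep_finite by (simp add: truncation_def)
  then show "\<exists>x\<in>J - I. indep (truncation M) (insert x I)"
    using indep_augment[of I J] IJ by (auto simp: truncation_def)
next
  fix I J assume "indep (truncation M) I" "J \<subseteq> I"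
  then show "indep (truncation M) J"
    using indep_subset[of I J] indep_finite[of I] card_mono[of I J]
    by (auto simp: truncation_def)
qed (use indep_subset_ground in \<open>auto simp: truncation_def finite_ground indep_empty\<close>)

lemma loopless_truncation: "loopless M \<Longrightarrow> 2 \<le> rk M \<Longrightarrow> loopless (truncation M)"
  by (auto simp: loopless_def truncation_def)

text \<open>A largest independent subset of \<open>A\<close> can be shrunk to the permitted size and
  stays independent.\<close>

lemma rank_of_truncation: "rank_of (truncation M) A = min (rank_of M A) (rk M - 1)"
proof -
  let ?S = "{card I | I. I \<subseteq> A \<and> indep (truncation M) I}"
  have le: "n \<le> min (rank_of M A) (rk M - 1)" if "n \<in> ?S" for n
    using that card_indep_le_rank_of[of _ A] by (auto simp: truncation_def)
  have ex: "min (rank_of M A) (rk M - 1) \<in> ?S"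
  proof -
    obtain I where I: "I \<subseteq> A" "indep M I" "card I = rank_of M A" using rank_of_witness by blast
    obtain J where J: "J \<subseteq> I" "card J = min (rank_of M A) (rk M - 1)"
      using obtain_subset_with_card_n[of "min (rank_of M A) (rk M - 1)" I] I(3)
      by (metis min.cobounded1)
    then have "J \<subseteq> A" "indep (truncation M) J"
      using I(1) indep_subset[OF I(2)] by (simp_all add: truncation_def)
    then show ?thesis using J by (metis (mono_tags, lifting) mem_Collect_eq)
  qed
  show ?thesis
    unfolding rank_of_def[of "truncation M"]
  proof (rule Max_eqI)
    show "finite ?S"
      by (rule finite_subset[of _ "{..min (rank_of M A) (rk M - 1)}"]) (use le atMost_iff in blast)+
  qed (use le ex in blast)+
qed

text \<open>A new element changes the capped rank iff it changes the rank in \<open>M\<close> and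
  the old rank lies below the cap \<open>rk M - 1\<close>. Hence only proper flats below the cap
  survive, with the ground set on top.\<close>

lemma flats_truncation:
  "flats (truncation M) = {F \<in> flats M. Suc (rank_of M F) < rk M} \<union> {ground M}"
proof -
  have g: "ground (truncation M) = ground M" by (simp add: truncation_def)
  have "F \<in> flats (truncation M) \<longleftrightarrow> F \<in> flats M \<and> Suc (rank_of M F) < rk M"
    if "F \<subset> ground M" for F
  proof -
    have ins: "rank_of M (insert x F) = rank_of M F \<or> rank_of M (insert x F) = Suc (rank_of M F)"
      for x
      using rank_of_insert_le[of x F] rank_of_insert_ge[of F x] by linarith
    have "rank_of (truncation M) F < rank_of (truncation M) (insert x F) \<longleftrightarrow>
        rank_of M F < rank_of M (insert x F) \<and> Suc (rank_of M F) < rk M" for x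
      unfolding rank_of_truncation using ins[of x] by auto
    then show ?thesis
      using that unfolding flats_def g by blast
  qed
  moreover have "F \<subset> ground M" if "F \<in> flats M" "Suc (rank_of M F) < rk M" for F
    using that by (auto simp: flats_def rk_def)
  moreover have "ground M \<in> flats (truncation M)" by (simp add: flats_def g)
  moreover have "F \<subseteq> ground M" if "F \<in> flats (truncation M)" for F
    using that by (simp add: flats_def g)
  ultimately show ?thesis by blast
qed

end

section \<open>Vanishing order at the origin\<close>

text \<open>Order of vanishing at least \<open>k\<close> at \<open>0\<close>: divisibility by the
  \<open>k\<close>-th power of the variable in the local ring of rational functions regular at
  \<open>0\<close>.\<close>

definition vanishes :: "nat \<Rightarrow> ratfun \<Rightarrow> bool" where
  "vanishes k q \<longleftrightarrow> (\<exists>u. \<not> ratfun_pole u 0 \<and> q = ratfun_var ^ k * u)"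

lemma ratfun_deriv_add: "ratfun_deriv (p + q) = ratfun_deriv p + ratfun_deriv q"
proof (cases p, cases q)
  fix a b c d :: "rat poly"
  assume "p = Fract a b" "b \<noteq> 0" "q = Fract c d" "d \<noteq> 0"
  then show ?thesis
    by (simp add: ratfun_deriv_Fract eq_fract pderiv_add pderiv_mult) (simp add: algebra_simps)
qed

lemma ratfun_deriv_funpow_add:
  "(ratfun_deriv ^^ j) (p + q) = (ratfun_deriv ^^ j) p + (ratfun_deriv ^^ j) q"
  by (induction j) (simp_all add: ratfun_deriv_add)

lemma ratfun_deriv_var_mult: "ratfun_deriv (ratfun_var * q) = q + ratfun_var * ratfun_deriv q"
proof (cases q)
  fix a b :: "rat poly"
  assume "q = Fract a b" "b \<noteq> 0"
  then show ?thesis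
    by (simp add: ratfun_var_def to_fract_def ratfun_deriv_Fract eq_fract pderiv_mult pderiv_pCons)
       (simp add: algebra_simps)
qed

lemma ratfun_eval_add:
  "\<not> ratfun_pole p x \<Longrightarrow> \<not> ratfun_pole q x \<Longrightarrow>
    ratfun_eval (p + q) x = ratfun_eval p x + ratfun_eval q x"
  by (elim ratfun_not_poleE) (simp add: ratfun_eval_Fract add_frac_eq)

lemma ratfun_not_pole_deriv_funpow: "\<not> ratfun_pole q x \<Longrightarrow> \<not> ratfun_pole ((ratfun_deriv ^^ j) q) x"
  by (induction j) (simp_all add: ratfun_not_pole_deriv)

lemma vanishes_0_iff: "vanishes 0 q \<longleftrightarrow> \<not> ratfun_pole q 0"
  by (simp add: vanishes_def)

lemma vanishes_Suc_iff: "vanishes (Suc k) q \<longleftrightarrow> (\<exists>p. vanishes k p \<and> q = ratfun_var * p)"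
  by (auto simp: vanishes_def mult.assoc)

lemma vanishes_not_pole: "vanishes k q \<Longrightarrow> \<not> ratfun_pole q 0"
  by (induction k arbitrary: q)
     (auto simp: vanishes_0_iff vanishes_Suc_iff ratfun_var_def
       ratfun_not_pole_mult ratfun_not_pole_to_fract)

lemma vanishes_add: "vanishes k p \<Longrightarrow> vanishes k q \<Longrightarrow> vanishes k (p + q)"
  unfolding vanishes_def by (metis ratfun_not_pole_add distrib_left)

lemma vanishes_mult: "\<not> ratfun_pole p 0 \<Longrightarrow> vanishes k q \<Longrightarrow> vanishes k (p * q)"
  unfolding vanishes_def by (metis ratfun_not_pole_mult mult.left_commute)

lemma vanishes_sum: "(\<And>i. i \<in> A \<Longrightarrow> vanishes k (f i)) \<Longrightarrow> vanishes k (sum f A)"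
  by (induction A rule: infinite_finite_induct)
     (auto simp: vanishes_add vanishes_def[of k 0] ratfun_not_pole_to_fract[of 0, simplified]
       intro!: exI[of _ 0])

lemma ratfun_not_pole_of_nat: "\<not> ratfun_pole (of_nat n) x"
  using ratfun_not_pole_to_fract[of "of_nat n"] by (simp add: to_fract_of_nat)

text \<open>For \<open>q = ratfun_var * p\<close> the derivative is
  \<open>p + ratfun_var * ratfun_deriv p\<close>. By induction \<open>ratfun_deriv p\<close> loses
  one order, which the factor \<open>ratfun_var\<close> restores.\<close>

lemma vanishes_deriv: "vanishes (Suc k) q \<Longrightarrow> vanishes k (ratfun_deriv q)"
proof (induction k arbitrary: q)
  case 0
  then show ?case
    using ratfun_not_pole_deriv vanishes_not_pole by (simp add: vanishes_0_iff)
next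
  case (Suc k)
  then obtain p where p: "vanishes (Suc k) p" "q = ratfun_var * p"
    unfolding vanishes_Suc_iff[of "Suc k"] by blast
  moreover have "vanishes (Suc k) (ratfun_var * ratfun_deriv p)"
    using Suc.IH p(1) vanishes_Suc_iff by blast
  ultimately show ?case by (simp add: ratfun_deriv_var_mult vanishes_add)
qed

lemma ratfun_eval_vanishes: "vanishes (Suc k) q \<Longrightarrow> ratfun_eval q 0 = 0"
  unfolding vanishes_Suc_iff
  by (elim exE conjE vanishes_not_pole[THEN ratfun_not_poleE])
     (simp add: ratfun_eval_Fract ratfun_var_def to_fract_def)

text \<open>Each differentiation costs at most one order, so after \<open>j < k\<close> of them a
  factor \<open>ratfun_var\<close> is left.\<close>

lemma ratfun_eval_deriv_vanishes:
  "vanishes k q \<Longrightarrow> j < k \<Longrightarrow> ratfun_eval ((ratfun_deriv ^^ j) q) 0 = 0"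
proof (induction j arbitrary: k q)
  case 0
  then show ?case using ratfun_eval_vanishes[of "k - 1"] by simp
next
  case (Suc j)
  then have "vanishes (k - 1) (ratfun_deriv q)" "j < k - 1"
    using vanishes_deriv[of "k - 1"] by simp_all
  then show ?case unfolding funpow_Suc_right o_def by (rule Suc.IH)
qed

text \<open>Shows the denominators of both recursions as polynomials with constant term
  \<open>k\<close>, hence nonzero and invertible at \<open>0\<close> for
  \<open>k > 0\<close>.\<close>

lemma linear_ratfun_eq: "of_nat n * ratfun_var + of_nat k = to_fract [:of_nat k, of_nat n:]"
proof -
  have "[:of_nat k, of_nat n:] = of_nat n * [:0, 1:] + (of_nat k :: rat poly)"
    by (simp add: of_nat_poly)
  then show ?thesis
    by (simp only: ratfun_var_def to_fract_of_nat to_fract_add to_fract_mult)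
qed

lemma linear_ratfun_nonzero: "k > 0 \<Longrightarrow> of_nat n * ratfun_var + of_nat k \<noteq> 0"
  by (simp add: linear_ratfun_eq)

lemma linear_ratfun_inverse_not_pole:
  "k > 0 \<Longrightarrow> \<not> ratfun_pole (1 / (of_nat n * ratfun_var + of_nat k)) 0"
  unfolding linear_ratfun_eq
  by (simp add: ratfun_not_pole_Fract to_fract_def One_fract_def)

section \<open>Weights of flats\<close>

text \<open>The weight \<open>w\<close> of the overview. Covers are recognised by rank, so that the
  recursion descends in rank for every \<open>M\<close>.\<close>

function flat_weight :: "'a indep_system \<Rightarrow> 'a set \<Rightarrow> ratfun" where
  "flat_weight M F =
     (if rank_of M F = 0 then 1
      else - ratfun_var / (of_nat (card F) * ratfun_var + of_nat (rank_of M F)) *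
        (\<Sum>H\<in>{H \<in> flats M. H \<subseteq> F \<and> rank_of M F = Suc (rank_of M H)}.
           of_nat (card (F - H)) * flat_weight M H))"
  by auto
termination
  by (relation "measure (\<lambda>(M, F). rank_of M F)") auto

declare flat_weight.simps [simp del]

text \<open>The recursion visits only flats inside \<open>F\<close>. This carries weights over to
  restrictions and to the truncation.\<close>

lemma flat_weight_cong:
  assumes "\<And>G. G \<subseteq> F \<Longrightarrow> G \<in> flats M \<longleftrightarrow> G \<in> flats N"
    and "\<And>G. G \<subseteq> F \<Longrightarrow> G \<in> flats M \<Longrightarrow> rank_of M G = rank_of N G"
    and "F \<in> flats M"
  shows "flat_weight M F = flat_weight N F"
  using assms
proof (induction M F rule: flat_weight.induct)
  case (1 M F)
  have rk: "rank_of M F = rank_of N F" using "1.prems" by blast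
  show ?case
  proof (cases "rank_of M F = 0")
    case True
    then show ?thesis using rk by (simp add: flat_weight.simps)
  next
    case False
    let ?C = "\<lambda>M. {H \<in> flats M. H \<subseteq> F \<and> rank_of M F = Suc (rank_of M H)}"
    have C: "?C M = ?C N" using "1.prems" rk by auto
    have "flat_weight M H = flat_weight N H" if "H \<in> ?C M" for H
      by (rule "1.IH"[OF False that]) (use that "1.prems" in blast)+
    then have "(\<Sum>H\<in>?C M. of_nat (card (F - H)) * flat_weight M H) =
        (\<Sum>H\<in>?C N. of_nat (card (F - H)) * flat_weight N H)"
      unfolding C[symmetric] by simp
    then show ?thesis
      unfolding flat_weight.simps[of M F] flat_weight.simps[of N F] rk by (simp only:)
  qed
qed

text \<open>Every step of the recursion goes down one rank and contributes one factor
  \<open>ratfun_var\<close>; the denominator is invertible at \<open>0\<close>.\<close>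

lemma vanishes_flat_weight: "vanishes (rank_of M F) (flat_weight M F)"
proof (induction M F rule: flat_weight.induct)
  case (1 M F)
  show ?case
  proof (cases "rank_of M F")
    case 0
    then show ?thesis
      using ratfun_not_pole_of_nat[of 1] by (simp add: flat_weight.simps vanishes_0_iff)
  next
    case (Suc k)
    let ?C = "{H \<in> flats M. H \<subseteq> F \<and> rank_of M F = Suc (rank_of M H)}"
    let ?S = "\<Sum>H\<in>?C. of_nat (card (F - H)) * flat_weight M H"
    let ?d = "of_nat (card F) * ratfun_var + of_nat (rank_of M F)"
    have "vanishes k ?S"
      using 1 Suc by (intro vanishes_sum vanishes_mult ratfun_not_pole_of_nat) auto
    then have "vanishes (Suc k) (ratfun_var * ?S)" using vanishes_Suc_iff by blast
    moreover have "\<not> ratfun_pole (of_int (-1) * (1 / ?d)) 0"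
      using Suc ratfun_not_pole_to_fract[of "of_int (-1)"]
      by (intro ratfun_not_pole_mult linear_ratfun_inverse_not_pole) (simp_all add: to_fract_of_int)
    ultimately have "vanishes (Suc k) (of_int (-1) * (1 / ?d) * (ratfun_var * ?S))"
      by (rule vanishes_mult[rotated])
    moreover have "flat_weight M F = of_int (-1) * (1 / ?d) * (ratfun_var * ?S)"
      using Suc by (subst flat_weight.simps) simp
    ultimately show ?thesis using Suc by simp
  qed
qed

text \<open>With the denominator cleared, the recursion also covers rank \<open>0\<close>:
  looplessness gives \<open>F = {}\<close>, and both sides are \<open>0\<close>.\<close>

lemma flat_weight_rec:
  assumes "matroid M" "loopless M" "F \<in> flats M"
  shows "(of_nat (card F) * ratfun_var + of_nat (rank_of M F)) * flat_weight M F =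
    - ratfun_var * (\<Sum>H\<in>{H \<in> flats M. H \<subseteq> F \<and> rank_of M F = Suc (rank_of M H)}.
           of_nat (card (F - H)) * flat_weight M H)"
proof (cases "rank_of M F = 0")
  case True
  then have "F = {}" using flat_rank_0 assms by blast
  then show ?thesis using True by simp
next
  case False
  then show ?thesis
    using linear_ratfun_nonzero[of "rank_of M F" "card F"] by (subst flat_weight.simps) simp
qed

text \<open>Sum \<open>flat_weight_rec\<close> over the levels chosen by \<open>Q\<close> and
  exchange \<open>F\<close> with the flats \<open>H\<close> it covers; the flats covering
  \<open>H\<close> partition \<open>ground M - H\<close>. It is applied with all levels for
  \<open>ztop M\<close> and with a single level for the truncation.\<close>

lemma sum_flat_weight_covers:
  assumes M: "matroid M" "loopless M"
  shows "(\<Sum>F\<in>{F \<in> flats M. Q (rank_of M F)}.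
      (of_nat (card F) * ratfun_var + of_nat (rank_of M F)) * flat_weight M F) =
    - ratfun_var * (\<Sum>H\<in>{H \<in> flats M. Q (Suc (rank_of M H))}.
      of_nat (card (ground M - H)) * flat_weight M H)"
proof -
  let ?A = "{F \<in> flats M. Q (rank_of M F)}" and ?B = "{H \<in> flats M. Q (Suc (rank_of M H))}"
  let ?R = "\<lambda>F H. H \<subseteq> F \<and> rank_of M F = Suc (rank_of M H)"
  have fin: "finite ?A" "finite ?B" using finite_flats[OF M(1)] by simp_all
  have "(\<Sum>F\<in>?A. (of_nat (card F) * ratfun_var + of_nat (rank_of M F)) * flat_weight M F) =
    (\<Sum>F\<in>?A. - ratfun_var * (\<Sum>H\<in>{H \<in> ?B. ?R F H}. of_nat (card (F - H)) * flat_weight M H))"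
  proof (rule sum.cong)
    fix F assume F: "F \<in> ?A"
    then have eq: "{H \<in> flats M. ?R F H} = {H \<in> ?B. ?R F H}" by auto
    show "(of_nat (card F) * ratfun_var + of_nat (rank_of M F)) * flat_weight M F =
      - ratfun_var * (\<Sum>H\<in>{H \<in> ?B. ?R F H}. of_nat (card (F - H)) * flat_weight M H)"
      using flat_weight_rec[OF M, of F] F unfolding eq by blast
  qed simp
  also have "\<dots> = - ratfun_var *
      (\<Sum>F\<in>?A. \<Sum>H\<in>{H \<in> ?B. ?R F H}. of_nat (card (F - H)) * flat_weight M H)"
    by (simp only: sum_distrib_left)
  also have "(\<Sum>F\<in>?A. \<Sum>H\<in>{H \<in> ?B. ?R F H}. of_nat (card (F - H)) * flat_weight M H) =
      (\<Sum>H\<in>?B. \<Sum>F\<in>{F \<in> ?A. ?R F H}. of_nat (card (F - H)) * flat_weight M H)"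
    by (rule sum.swap_restrict[OF fin])
  also have "\<dots> = (\<Sum>H\<in>?B. of_nat (card (ground M - H)) * flat_weight M H)"
  proof (rule sum.cong)
    fix H assume H: "H \<in> ?B"
    then have "{F \<in> ?A. ?R F H} =
        {F \<in> flats M. H \<subseteq> F \<and> F \<subseteq> ground M \<and> rank_of M F = Suc (rank_of M H)}"
      using flats_subset_ground[OF M(1)] by auto
    then have "card (ground M - H) = (\<Sum>F\<in>{F \<in> ?A. ?R F H}. card (F - H))"
      using card_diff_eq_sum_covers[OF M(1), of H "ground M"] H
        ground_in_flats[OF M(1)] flats_subset_ground[OF M(1)] by simp
    then show "(\<Sum>F\<in>{F \<in> ?A. ?R F H}. of_nat (card (F - H)) * flat_weight M H) =
        of_nat (card (ground M - H)) * flat_weight M H"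
      by (simp flip: sum_distrib_right)
  qed simp
  finally show ?thesis .
qed

lemma card_add_card_Diff: "finite E \<Longrightarrow> F \<subseteq> E \<Longrightarrow> card F + card (E - F) = card E"
  using card_Diff_subset[of F E] card_mono[of E F] finite_subset[of F E] by simp

text \<open>Split the factor for each \<open>F\<close> into its corank, its own denominator, and
  \<open>ratfun_var\<close> times \<open>card (ground M - F)\<close>. Summed over all flats, the
  last two parts cancel by \<open>sum_flat_weight_covers\<close>.\<close>

lemma sum_flat_weight_corank:
  assumes M: "matroid M" "loopless M"
  shows "(of_nat (card (ground M)) * ratfun_var + of_nat (rk M)) * (\<Sum>F\<in>flats M. flat_weight M F) =
    (\<Sum>F\<in>flats M. flat_weight M F * of_nat (rk M - rank_of M F))"
proof -
  let ?w = "flat_weight M" and ?s = ratfun_var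
  have split: "(of_nat (card (ground M)) * ?s + of_nat (rk M)) * ?w F =
      ?w F * of_nat (rk M - rank_of M F) + ((of_nat (card F) * ?s + of_nat (rank_of M F)) * ?w F
        + ?s * (of_nat (card (ground M - F)) * ?w F))" if "F \<in> flats M" for F
  proof -
    have F: "F \<subseteq> ground M" using that flats_subset_ground[OF M(1)] by blast
    have "card F + card (ground M - F) = card (ground M)"
      by (rule card_add_card_Diff[OF finite_ground[OF M(1)] F])
    moreover have "rk M - rank_of M F + rank_of M F = rk M"
      using rank_of_le_rk[OF M(1) F] by simp
    moreover have "(of_nat (a + b) * ?s + of_nat (c + d)) * x =
        x * of_nat c + ((of_nat a * ?s + of_nat d) * x + ?s * (of_nat b * x))" for a b c d x
      by (simp add: algebra_simps)
    ultimately show ?thesis by metis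
  qed
  have "(of_nat (card (ground M)) * ?s + of_nat (rk M)) * (\<Sum>F\<in>flats M. ?w F) =
    (\<Sum>F\<in>flats M. ?w F * of_nat (rk M - rank_of M F)) +
    ((\<Sum>F\<in>flats M. (of_nat (card F) * ?s + of_nat (rank_of M F)) * ?w F)
      + ?s * (\<Sum>F\<in>flats M. of_nat (card (ground M - F)) * ?w F))"
    unfolding sum_distrib_left sum.distrib[symmetric] by (rule sum.cong[OF refl split])
  then show ?thesis
    using sum_flat_weight_covers[OF M, of "\<lambda>_. True"] by simp
qed

text \<open>By induction each proper restriction is a partial sum of weights. Exchanging sums turns
  the characteristic polynomials into coranks, and \<open>sum_flat_weight_corank\<close> cancels the
  denominator.\<close>

lemma ztop_eq_sum_flat_weight:
  "matroid M \<Longrightarrow> loopless M \<Longrightarrow> ztop M = (\<Sum>F\<in>flats M. flat_weight M F)"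
proof (induction M rule: ztop.induct)
  case (1 M)
  note M = "1.prems"
  let ?w = "flat_weight M"
  have fin: "finite (ground M)" "finite (flats M)" using finite_ground finite_flats M by blast+
  show ?case
  proof (cases "rk M = 0")
    case True
    then have "ground M = {}"
      using flat_rank_0[OF M ground_in_flats[OF M(1)]] by (simp add: rk_def)
    then have "flats M = {{}}" using ground_in_flats[OF M(1)] flats_subset_ground[OF M(1)] by auto
    then show ?thesis
      using True rank_of_empty[OF M(1)] by (simp add: ztop.simps flat_weight.simps)
  next
    case False
    let ?b = "\<lambda>F. poly (reduced_charpoly (contraction M F)) 1"
    let ?d = "of_nat (card (ground M)) * ratfun_var + of_nat (rk M) :: ratfun"
    have IH: "ztop (restriction M F) = (\<Sum>G\<in>{G \<in> flats M. G \<subseteq> F}. ?w G)"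
      if F: "F \<in> flats M - {ground M}" for F
    proof -
      have fl: "flats (restriction M F) = {G \<in> flats M. G \<subseteq> F}"
        using flats_restriction[OF M(1)] F by blast
      have "ztop (restriction M F) = (\<Sum>G\<in>flats (restriction M F). flat_weight (restriction M F) G)"
        using False fin F matroid_restriction[OF M(1)] loopless_restriction[OF M]
        by (intro "1.IH") auto
      also have "\<dots> = (\<Sum>G\<in>{G \<in> flats M. G \<subseteq> F}. ?w G)"
        unfolding fl
      proof (rule sum.cong)
        fix G assume G: "G \<in> {G \<in> flats M. G \<subseteq> F}"
        show "flat_weight (restriction M F) G = ?w G"
          by (rule flat_weight_cong) (use G fl rank_of_restriction[OF M(1)] in auto)
      qed simp
      finally show ?thesis .
    qed
    have "(\<Sum>F\<in>flats M - {ground M}. ztop (restriction M F) * of_int (?b F)) =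
        (\<Sum>F\<in>flats M - {ground M}. \<Sum>G\<in>{G \<in> flats M. G \<subseteq> F}. ?w G * of_int (?b F))"
      by (intro sum.cong refl) (simp add: IH sum_distrib_right)
    \<comment> \<open>\<open>G = ground M\<close> enters with an empty inner sum, in accordance with
      its corank \<open>0\<close>.\<close>
    also have "\<dots> = (\<Sum>G\<in>flats M. \<Sum>F\<in>{F \<in> flats M - {ground M}. G \<subseteq> F}. ?w G * of_int (?b F))"
      using fin by (intro sum.swap_restrict) auto
    also have "\<dots> = (\<Sum>G\<in>flats M. ?w G * of_int (\<Sum>F\<in>{F \<in> flats M - {ground M}. G \<subseteq> F}. ?b F))"
      by (simp only: of_int_sum sum_distrib_left)
    also have "\<dots> = (\<Sum>G\<in>flats M. ?w G * of_nat (rk M - rank_of M G))"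
      by (intro sum.cong refl) (simp only: sum_reduced_charpoly_at_1[OF M(1)] of_int_of_nat_eq)
    also have "\<dots> = ?d * (\<Sum>F\<in>flats M. ?w F)"
      by (rule sum_flat_weight_corank[OF M, symmetric])
    finally have "ztop M = 1 / ?d * (?d * (\<Sum>F\<in>flats M. ?w F))"
      using False fin by (subst ztop.simps) (simp only: simp_thms if_False)
    then show ?thesis
      using linear_ratfun_nonzero[of "rk M" "card (ground M)"] False by simp
  qed
qed

section \<open>Comparison with the truncation\<close>

text \<open>Truncation changes neither flats nor ranks below the cap, and a weight depends only on
  what lies inside \<open>F\<close>.\<close>

lemma flat_weight_truncation:
  assumes M: "matroid M" and F: "F \<in> flats M" "Suc (rank_of M F) < rk M"
  shows "flat_weight (truncation M) F = flat_weight M F"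
proof -
  have sub: "F \<subset> ground M"
    using F flats_subset_ground[OF M] by (force simp: rk_def)
  have small: "Suc (rank_of M G) < rk M" if "G \<subseteq> F" for G
    using rank_of_mono[OF M that] F by linarith
  have "G \<in> flats M \<longleftrightarrow> G \<in> flats (truncation M)" if "G \<subseteq> F" for G
    using small[OF that] that sub by (auto simp: flats_truncation[OF M])
  moreover have "rank_of M G = rank_of (truncation M) G" if "G \<subseteq> F" for G
    using small[OF that] by (simp add: rank_of_truncation[OF M])
  ultimately show ?thesis using F(1) by (intro flat_weight_cong[symmetric]) auto
qed

text \<open>After the common weights cancel, the top weight of \<open>M\<close> has the required
  order. The weights of level \<open>rk M - 1\<close> and the top weight of the truncation are each
  guaranteed one order less, but their difference gains a factor \<open>ratfun_var\<close>.\<close>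

lemma vanishes_ztop_diff:
  assumes M: "matroid M" "loopless M" and pos: "rk M > 0"
  shows "vanishes (rk M) (ztop M - ztop (truncation M))"
proof -
  let ?E = "ground M" and ?w = "flat_weight M" and ?T = "truncation M" and ?s = ratfun_var
  have E: "?E \<in> flats M" "rank_of M ?E = rk M"
    using ground_in_flats[OF M(1)] by (simp_all add: rk_def)
  have fin: "finite (flats M)" using finite_flats M by blast
  have top: "F = ?E" if "F \<in> flats M" "rank_of M F = rk M" for F
    using flat_eqI[OF M(1) that(1) flats_subset_ground[OF M(1) that(1)]] that E by simp
  have le: "rank_of M F \<le> rk M" if "F \<in> flats M" for F
    using rank_of_le_rk[OF M(1)] flats_subset_ground[OF M(1) that] by blast
  have wE: "vanishes (rk M) (?w ?E)"
    using vanishes_flat_weight[of M ?E] E by simp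
  show ?thesis
  \<comment> \<open>In rank \<open>1\<close> every element is a loop of the truncation, so the
    description by weights does not apply; \<open>ztop\<close> is \<open>1\<close> by its rank
    \<open>0\<close> clause.\<close>
  proof (cases "rk M = 1")
    case True
    have "flats M = {{}, ?E}"
    proof -
      have "F = {} \<or> F = ?E" if "F \<in> flats M" for F
        using le[OF that] top[OF that] flat_rank_0[OF M that] True by linarith
      then show ?thesis using E empty_in_flats[OF M] by blast
    qed
    moreover have "?E \<noteq> {}" using E rank_of_empty[OF M(1)] True by force
    ultimately have "ztop M = 1 + ?w ?E"
      using ztop_eq_sum_flat_weight[OF M] rank_of_empty[OF M(1)]
      by (simp add: flat_weight.simps[of M "{}"])
    moreover have "ztop ?T = 1"
      using rank_of_truncation[OF M(1)] True by (simp add: ztop.simps rk_def truncation_def)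
    ultimately show ?thesis using wE by simp
  next
    case False
    \<comment> \<open>Ranks up to \<open>k\<close> are shared with the truncation,
      \<open>Suc k\<close> is the collapsed level, and \<open>Suc (Suc k)\<close> is the top of
      \<open>M\<close>.\<close>
    define k where "k = rk M - 2"
    have k: "rk M = Suc (Suc k)" using False pos by (simp add: k_def)
    have T: "matroid ?T" "loopless ?T" "ground ?T = ?E"
      using matroid_truncation[OF M(1)] loopless_truncation[OF M] k
      by (simp_all, simp add: truncation_def)
    let ?L = "{F \<in> flats M. rank_of M F \<le> k}" and ?H = "{F \<in> flats M. rank_of M F = Suc k}"
    have flatsM: "flats M = insert ?E (?L \<union> ?H)"
    proof -
      have "F \<in> insert ?E (?L \<union> ?H)" if F: "F \<in> flats M" for F
      proof -
        consider "rank_of M F = rk M" | "rank_of M F \<le> k" | "rank_of M F = Suc k"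
          using le[OF F] k by linarith
        then show ?thesis using F top by cases blast+
      qed
      then show ?thesis using E(1) by blast
    qed
    have flatsT: "flats ?T = insert ?E ?L"
      unfolding flats_truncation[OF M(1)] k by auto
    have ztopM: "ztop M = ?w ?E + (sum ?w ?L + sum ?w ?H)"
    proof -
      have "sum ?w (insert ?E (?L \<union> ?H)) = ?w ?E + sum ?w (?L \<union> ?H)"
        using fin E k by (intro sum.insert) auto
      also have "sum ?w (?L \<union> ?H) = sum ?w ?L + sum ?w ?H"
        using fin by (intro sum.union_disjoint) auto
      finally show ?thesis using ztop_eq_sum_flat_weight[OF M] flatsM by simp
    qed
    have wT: "flat_weight ?T F = ?w F" if "F \<in> ?L" for F
      using flat_weight_truncation[OF M(1)] that k by auto
    have "ztop ?T = sum (flat_weight ?T) (insert ?E ?L)"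
      using ztop_eq_sum_flat_weight[OF T(1,2)] flatsT by simp
    also have "\<dots> = flat_weight ?T ?E + sum (flat_weight ?T) ?L"
      using fin E k by (intro sum.insert) auto
    also have "sum (flat_weight ?T) ?L = sum ?w ?L"
      using wT by (intro sum.cong) auto
    finally have ztopT: "ztop ?T = flat_weight ?T ?E + sum ?w ?L" .
    let ?d = "of_nat (card ?E) * ?s + of_nat (Suc k)"
    have rT: "rank_of ?T F = min (rank_of M F) (Suc k)" for F
      using rank_of_truncation[OF M(1)] k by simp
    have "?d * flat_weight ?T ?E = - ?s * (\<Sum>H\<in>{H \<in> flats ?T. H \<subseteq> ?E \<and>
        rank_of ?T ?E = Suc (rank_of ?T H)}. of_nat (card (?E - H)) * flat_weight ?T H)"
      using flat_weight_rec[OF T(1,2), of ?E] ground_in_flats[OF T(1)] T(3) rT E(2) k by simp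
    \<comment> \<open>In the truncation \<open>?E\<close> has rank \<open>Suc k\<close>, so it
      covers the flats of rank \<open>k\<close>. The form with \<open>Suc\<close> matches
      \<open>sum_flat_weight_covers\<close> at level \<open>Suc k\<close>.\<close>
    also have "{H \<in> flats ?T. H \<subseteq> ?E \<and> rank_of ?T ?E = Suc (rank_of ?T H)} =
        {H \<in> flats M. Suc (rank_of M H) = Suc k}"
      using flats_subset_ground[OF M(1)] E k by (auto simp: flatsT rT)
    also have "(\<Sum>H\<in>\<dots>. of_nat (card (?E - H)) * flat_weight ?T H) =
        (\<Sum>H\<in>{H \<in> flats M. Suc (rank_of M H) = Suc k}. of_nat (card (?E - H)) * ?w H)"
      using wT by (intro sum.cong) auto
    also have "- ?s * \<dots> = (\<Sum>F\<in>?H. (of_nat (card F) * ?s + of_nat (rank_of M F)) * ?w F)"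
      by (rule sum_flat_weight_covers[OF M, symmetric])
    finally have wTE: "?d * flat_weight ?T ?E =
      (\<Sum>F\<in>?H. (of_nat (card F) * ?s + of_nat (rank_of M F)) * ?w F)" .
    \<comment> \<open>At level \<open>Suc k\<close> the denominator of \<open>F\<close> has the
      constant term of \<open>?d\<close>; the coefficients of \<open>?s\<close> differ by
      \<open>card (?E - F)\<close>.\<close>
    have "?d * ?w F = (of_nat (card F) * ?s + of_nat (rank_of M F)) * ?w F +
        of_nat (card (?E - F)) * (?s * ?w F)" if "F \<in> ?H" for F
    proof -
      have F: "F \<subseteq> ?E" using that flats_subset_ground[OF M(1)] by blast
      have "card ?E = card F + card (?E - F)"
        by (rule card_add_card_Diff[OF finite_ground[OF M(1)] F, symmetric])
      then have "?d * ?w F =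
          (of_nat (card F + card (?E - F)) * ?s + of_nat (rank_of M F)) * ?w F"
        using that by simp
      then show ?thesis by (simp only: of_nat_add algebra_simps)
    qed
    then have "?d * sum ?w ?H = ?d * flat_weight ?T ?E +
        (\<Sum>F\<in>?H. of_nat (card (?E - F)) * (?s * ?w F))"
      unfolding wTE sum_distrib_left sum.distrib[symmetric] by (rule sum.cong[OF refl])
    then have "?d * (sum ?w ?H - flat_weight ?T ?E) =
        (\<Sum>F\<in>?H. of_nat (card (?E - F)) * (?s * ?w F))"
      unfolding right_diff_distrib by (simp only: add_diff_cancel_left')
    \<comment> \<open>The weight supplies order \<open>Suc k\<close>, the explicit \<open>?s\<close>
      one more.\<close>
    moreover have "vanishes (rk M) (\<Sum>F\<in>?H. of_nat (card (?E - F)) * (?s * ?w F))"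
    proof (rule vanishes_sum, rule vanishes_mult[OF ratfun_not_pole_of_nat])
      fix F assume "F \<in> ?H"
      then have "vanishes (Suc k) (?w F)" using vanishes_flat_weight[of M F] by simp
      then show "vanishes (rk M) (?s * ?w F)" unfolding k vanishes_Suc_iff[of "Suc k"] by blast
    qed
    ultimately have "vanishes (rk M) (?d * (sum ?w ?H - flat_weight ?T ?E))"
      by (simp only:)
    then have "vanishes (rk M) (1 / ?d * (?d * (sum ?w ?H - flat_weight ?T ?E)))"
      by (rule vanishes_mult[OF linear_ratfun_inverse_not_pole[OF zero_less_Suc]])
    then have "vanishes (rk M) (sum ?w ?H - flat_weight ?T ?E)"
      using linear_ratfun_nonzero[of "Suc k" "card ?E"] by simp
    then have "vanishes (rk M) ((sum ?w ?H - flat_weight ?T ?E) + ?w ?E)"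
      using wE by (rule vanishes_add)
    then show ?thesis by (simp add: ztopM ztopT algebra_simps)
  qed
qed

theorem theorem1p3:
  fixes M :: "'a indep_system" and r j :: nat
  assumes "matroid M" and "loopless M" and "rk M = r" and "r > 0"
    and "j < r"
  shows "ratfun_eval ((ratfun_deriv ^^ j) (ztop M)) 0 =
         ratfun_eval ((ratfun_deriv ^^ j) (ztop (truncation M))) 0"
proof -
  let ?D = "ztop M - ztop (truncation M)"
  have D: "vanishes r ?D" using vanishes_ztop_diff assms by blast
  \<comment> \<open>Values at poles are conventional, so evaluation is split only after both
    summands are known to be regular at \<open>0\<close>.\<close>
  have "ratfun_eval ((ratfun_deriv ^^ j) (ztop (truncation M) + ?D)) 0 =
      ratfun_eval ((ratfun_deriv ^^ j) (ztop (truncation M))) 0 + ratfun_eval ((ratfun_deriv ^^ j) ?D) 0"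
    unfolding ratfun_deriv_funpow_add
    by (intro ratfun_eval_add ratfun_not_pole_deriv_funpow ztop_not_pole_0 vanishes_not_pole[OF D])
  then show ?thesis using ratfun_eval_deriv_vanishes[OF D assms(5)] by simp
qed

end
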